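(* Let $G=(V(G),E(G))$ be a graph and let $n\geq 4$ be an integer. Then $$\gamma_{coe}\big(G^{\frac{1}{n}}\big)\leq |V(G)|+\gamma(P_{n-3})\,|E(G)|.$$
   Context: All graphs are finite and simple. A set $D\subseteq V$ is a dominating set of a graph $H=(V,E)$ if every vertex of $V-D$ is adjacent to at least one vertex of $D$; the domination number $\gamma(H)$ is the minimum cardinality of a dominating set of $H$. A dominating set $D$ is a co-even dominating set of $H$ if the degree (in $H$) of every vertex of $V-D$ is even. The co-even domination number $\gamma_{coe}(H)$ is the minimum cardinality of a co-even dominating set of $H$. $P_m$ denotes the path graph on $m$ vertices. For a positive integer $k$, the $k$-subdivision $G^{\frac{1}{k}}$ of a graph $G$ is the graph obtained by replacing each edge $uv$ of $G$ with a path of length $k$ (i.e. with $k$ edges) joining $u$ and $v$, whose $k-1$ internal vertices are new and distinct for distinct edges; thus $G^{\frac{1}{k}}$ has $|V(G)|+(k-1)|E(G)|$ vertices and $k|E(G)|$ edges. *)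

theory Defs
  imports Main
begin

record 'a graph =
  verts :: "'a set"
  edges :: "'a set set"

definition simple_graph :: "'a graph \<Rightarrow> bool" where
  "simple_graph G \<longleftrightarrow> finite (verts G) \<and> (\<forall>e\<in>edges G. e \<subseteq> verts G \<and> card e = 2)"

definition degree :: "'a graph \<Rightarrow> 'a \<Rightarrow> nat" where
  "degree G v = card {e \<in> edges G. v \<in> e}"

definition dominating_set :: "'a graph \<Rightarrow> 'a set \<Rightarrow> bool" where
  "dominating_set G D \<longleftrightarrow>
     D \<subseteq> verts G \<and> (\<forall>v \<in> verts G - D. \<exists>u\<in>D. {u, v} \<in> edges G)"

definition co_even_dominating_set :: "'a graph \<Rightarrow> 'a set \<Rightarrow> bool" where
  "co_even_dominating_set G D \<longleftrightarrow>
     dominating_set G D \<and> (\<forall>v \<in> verts G - D. even (degree G v))"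

definition domination_number :: "'a graph \<Rightarrow> nat" where
  "domination_number G = (LEAST k. \<exists>D. dominating_set G D \<and> card D = k)"

definition co_even_domination_number :: "'a graph \<Rightarrow> nat" where
  "co_even_domination_number G = (LEAST k. \<exists>D. co_even_dominating_set G D \<and> card D = k)"

definition path_graph :: "nat \<Rightarrow> nat graph" where
  "path_graph m = \<lparr>verts = {..<m}, edges = {{i, Suc i} |i. Suc i < m}\<rparr>"

text \<open>
  To place the internal vertices of a subdivided edge, every edge gets an arbitrary
  direction; another choice of directions gives an isomorphic subdivision.
  \<open>Inner e i\<close> is the new vertex at distance \<open>i\<close> from \<open>edge_src e\<close> on the path replacing \<open>e\<close>.
\<close>

definition edge_src :: "'a set \<Rightarrow> 'a" where
  "edge_src e = (SOME u. u \<in> e)"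

definition edge_tgt :: "'a set \<Rightarrow> 'a" where
  "edge_tgt e = (SOME v. v \<in> e - {edge_src e})"

datatype 'a subdiv_vertex = Orig 'a | Inner "'a set" nat

definition subdiv_path :: "nat \<Rightarrow> 'a set \<Rightarrow> nat \<Rightarrow> 'a subdiv_vertex" where
  "subdiv_path k e i =
     (if i = 0 then Orig (edge_src e) else if i = k then Orig (edge_tgt e) else Inner e i)"

definition subdivision :: "nat \<Rightarrow> 'a graph \<Rightarrow> 'a subdiv_vertex graph" where
  "subdivision k G =
     \<lparr>verts = Orig ` verts G \<union> {Inner e i |e i. e \<in> edges G \<and> 0 < i \<and> i < k},
      edges = {{subdiv_path k e i, subdiv_path k e (Suc i)} |e i. e \<in> edges G \<and> i < k}\<rparr>"

lemma edge_eq_src_tgt: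
  assumes "card e = 2"
  shows "e = {edge_src e, edge_tgt e}" "edge_src e \<noteq> edge_tgt e"
proof -
  have fin: "finite e" using assms card.infinite by fastforce
  have s: "edge_src e \<in> e"
    unfolding edge_src_def using assms by (metis card.empty ex_in_conv someI_ex zero_neq_numeral)
  have "card (e - {edge_src e}) = 1" using s assms fin by simp
  then have "e - {edge_src e} \<noteq> {}" by fastforce
  then have t: "edge_tgt e \<in> e - {edge_src e}"
    unfolding edge_tgt_def by (metis ex_in_conv someI_ex)
  show ne: "edge_src e \<noteq> edge_tgt e" using t by auto
  have "{edge_src e, edge_tgt e} = e"
    by (rule card_subset_eq[OF fin]) (use s t ne assms in auto)
  then show "e = {edge_src e, edge_tgt e}" by simp
qed

lemma simple_graph_finite_edges: "simple_graph G \<Longrightarrow> finite (edges G)"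
  unfolding simple_graph_def by (meson Pow_iff finite_Pow_iff finite_subset subsetI)

lemma simple_graph_path_graph: "simple_graph (path_graph m)"
  unfolding simple_graph_def path_graph_def by auto

lemma subdiv_path_eq_iff:
  assumes "card e = 2" "i \<le> k" "j \<le> k" "0 < k"
  shows "subdiv_path k e i = subdiv_path k e j \<longleftrightarrow> i = j"
  using assms edge_eq_src_tgt(2)[OF assms(1)] by (auto simp: subdiv_path_def)

lemma simple_graph_subdivision:
  assumes "simple_graph G" "0 < k"
  shows "simple_graph (subdivision k G)"
proof -
  have "{Inner e i |e i. e \<in> edges G \<and> 0 < i \<and> i < k} \<subseteq> case_prod Inner ` (edges G \<times> {..<k})"
    by auto
  then have fin: "finite {Inner e i |e i. e \<in> edges G \<and> 0 < i \<and> i < k}"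
    by (rule finite_subset) (simp add: simple_graph_finite_edges[OF assms(1)])
  have on: "subdiv_path k e i \<in> verts (subdivision k G)" if "e \<in> edges G" "i \<le> k" for e i
  proof -
    have "card e = 2" "e \<subseteq> verts G" using that assms by (auto simp: simple_graph_def)
    then have "edge_src e \<in> verts G" "edge_tgt e \<in> verts G" using edge_eq_src_tgt(1)[of e] by blast+
    then show ?thesis using that by (auto simp: subdivision_def subdiv_path_def)
  qed
  have two: "card {subdiv_path k e i, subdiv_path k e (Suc i)} = 2"
    if "e \<in> edges G" "i < k" for e i
    using that assms subdiv_path_eq_iff[of e i k "Suc i"] by (auto simp: simple_graph_def card_2_iff)
  have "finite (verts (subdivision k G))"
    using fin assms(1) by (simp add: subdivision_def simple_graph_def)
  moreover have "e \<subseteq> verts (subdivision k G) \<and> card e = 2" if e: "e \<in> edges (subdivision k G)" for e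
  proof -
    obtain f i where "e = {subdiv_path k f i, subdiv_path k f (Suc i)}" "f \<in> edges G" "i < k"
      using e by (auto simp: subdivision_def)
    then show ?thesis using on[of f i] on[of f "Suc i"] two[of f i] by simp
  qed
  ultimately show ?thesis by (simp add: simple_graph_def)
qed

lemma card_verts_subdivision:
  assumes "simple_graph G"
  shows "card (verts (subdivision k G)) = card (verts G) + (k - 1) * card (edges G)"
proof -
  let ?I = "case_prod Inner ` (edges G \<times> {0<..<k})"
  have "verts (subdivision k G) = Orig ` verts G \<union> ?I"
    by (auto simp: subdivision_def)
  moreover have "card (Orig ` verts G \<union> ?I) = card (Orig ` verts G) + card ?I"
    by (rule card_Un_disjoint)
       (use assms simple_graph_finite_edges[OF assms] in \<open>auto simp: simple_graph_def\<close>)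
  moreover have "card (Orig ` verts G) = card (verts G)"
    by (rule card_image) (auto simp: inj_on_def)
  moreover have "card ?I = card (edges G \<times> {0<..<k})"
    by (rule card_image) (auto simp: inj_on_def)
  ultimately show ?thesis by (simp add: card_cartesian_product)
qed

lemma card_edges_subdivision:
  assumes "simple_graph G"
  shows "card (edges (subdivision k G)) = k * card (edges G)"
proof -
  let ?f = "\<lambda>(e, i). {subdiv_path k e i, subdiv_path k e (Suc i)}"
  have "edges (subdivision k G) = ?f ` (edges G \<times> {..<k})"
    by (auto simp: subdivision_def)
  moreover have "inj_on ?f (edges G \<times> {..<k})"
  proof (rule inj_onI, clarify)
    fix e i e' i'
    assume h: "e \<in> edges G" "e' \<in> edges G" "i < k" "i' < k"
      and eq: "{subdiv_path k e i, subdiv_path k e (Suc i)} =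
        {subdiv_path k e' i', subdiv_path k e' (Suc i')}"
    have c: "card e = 2" "card e' = 2" using h assms by (auto simp: simple_graph_def)
    have "e = e'"
    proof (cases "k = 1")
      case True
      then have "{edge_src e, edge_tgt e} = {edge_src e', edge_tgt e'}"
        using eq h by (auto simp: subdiv_path_def doubleton_eq_iff)
      then show ?thesis using c edge_eq_src_tgt(1) by metis
    next
      case False
      then show ?thesis
        using eq h by (auto simp: subdiv_path_def doubleton_eq_iff split: if_splits)
    qed
    moreover have "i = i'"
      using eq h c \<open>e = e'\<close> subdiv_path_eq_iff[OF c(2), of _ k]
      by (auto simp: doubleton_eq_iff Suc_le_eq)
    ultimately show "e = e' \<and> i = i'" by simp
  qed
  ultimately show ?thesis by (simp add: card_image card_cartesian_product)
qed

end

(* Take all original vertices and, on each subdivided edge, a minimum dominating set of the path on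
   the internal vertices 2, ..., n - 2; the internal vertices 1 and n - 1 are dominated by the ends
   of the edge. The vertices left out are all internal, hence have degree 2. *)
theory Submission
  imports Defs
begin

lemma domination_number_attained:
  obtains D where "dominating_set G D" "card D = domination_number G"
proof -
  \<comment> \<open>The set of all vertices dominates, so \<open>LEAST\<close> ranges over a
    nonempty set of sizes.\<close>
  have "\<exists>k D. dominating_set G D \<and> card D = k"
    by (auto simp: dominating_set_def)
  then have "\<exists>D. dominating_set G D \<and> card D = domination_number G"
    unfolding domination_number_def by (rule LeastI_ex)
  then show thesis using that by blast
qed

lemma co_even_domination_number_le:
  "co_even_dominating_set G D \<Longrightarrow> co_even_domination_number G \<le> card D"
  unfolding co_even_domination_number_def by (rule Least_le) blast

lemma subdiv_path_in_edges:
  "e \<in> edges G \<Longrightarrow> i < k \<Longrightarrow>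
    {subdiv_path k e i, subdiv_path k e (Suc i)} \<in> edges (subdivision k G)"
  by (auto simp: subdivision_def)

text \<open>An internal vertex lies only on the path that replaces its own edge, and there it meets
  just the segments before and after it.\<close>

lemma degree_subdivision_Inner:
  assumes "simple_graph G" "e \<in> edges G" "0 < i" "i < k"
  shows "degree (subdivision k G) (Inner e i) = 2"
proof -
  obtain j where j: "i = Suc j" using assms(3) gr0_conv_Suc by blast
  let ?p = "subdiv_path k e"
  have c: "card e = 2" using assms by (auto simp: simple_graph_def)
  have in_j: "?p i = Inner e i" using assms by (simp add: subdiv_path_def)
  have "{x \<in> edges (subdivision k G). Inner e i \<in> x} = {{?p j, ?p i}, {?p i, ?p (Suc i)}}"
  proof (intro equalityI subsetI)
    fix x assume "x \<in> {x \<in> edges (subdivision k G). Inner e i \<in> x}"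
    then obtain f l where x: "x = {subdiv_path k f l, subdiv_path k f (Suc l)}"
      and "Inner e i \<in> x" by (auto simp: subdivision_def)
    \<comment> \<open>\<open>Inner\<close> records both the edge and the position, so a segment
      containing \<open>Inner e i\<close> comes from \<open>e\<close> and starts or ends at position
      \<open>i\<close>.\<close>
    then have "f = e \<and> (l = i \<or> Suc l = i)"
      by (auto simp: subdiv_path_def split: if_splits)
    then show "x \<in> {{?p j, ?p i}, {?p i, ?p (Suc i)}}" using x j by auto
  next
    fix x assume "x \<in> {{?p j, ?p i}, {?p i, ?p (Suc i)}}"
    then show "x \<in> {x \<in> edges (subdivision k G). Inner e i \<in> x}"
      using subdiv_path_in_edges[OF assms(2), of j k] subdiv_path_in_edges[OF assms(2), of i k]
        assms in_j j by auto
  qed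
  \<comment> \<open>The outer ends sit at positions \<open>j\<close> and \<open>j + 2\<close>. These
    are different vertices even when both are original, since the two ends of \<open>e\<close> are
    distinct.\<close>
  moreover have "{?p j, ?p i} \<noteq> {?p i, ?p (Suc i)}"
    using subdiv_path_eq_iff[OF c, of j k "Suc i"] subdiv_path_eq_iff[OF c, of i k "Suc i"]
      assms j by (auto simp: doubleton_eq_iff)
  ultimately show ?thesis by (simp add: degree_def)
qed

lemma path_graph_edge_iff:
  "{u, v} \<in> edges (path_graph m) \<longleftrightarrow> u < m \<and> v < m \<and> (v = Suc u \<or> u = Suc v)"
  by (auto simp: path_graph_def doubleton_eq_iff)

text \<open>The path on \<open>n - 3\<close> vertices is numbered from 0 to \<open>n - 4\<close>, so
  the shift by 2 places it on positions 2 to \<open>n - 2\<close> of each subdivided edge.\<close>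

lemma co_even_dominating_set_subdivision:
  assumes G: "simple_graph G" and n: "n \<ge> 4"
    and A: "dominating_set (path_graph (n - 3)) A"
  shows "co_even_dominating_set (subdivision n G)
    (Orig ` verts G \<union> (\<lambda>(e, j). Inner e (j + 2)) ` (edges G \<times> A))"
    (is "co_even_dominating_set ?S ?D")
proof -
  have A_sub: "A \<subseteq> {..<n - 3}" using A by (simp add: dominating_set_def path_graph_def)
  have "?D \<subseteq> verts ?S"
    using A_sub n by (fastforce simp: subdivision_def)
  moreover have "(\<exists>u\<in>?D. {u, v} \<in> edges ?S) \<and> even (degree ?S v)" if v: "v \<in> verts ?S - ?D" for v
  proof -
    \<comment> \<open>Every original vertex belongs to \<open>?D\<close>, so \<open>v\<close> must
      be internal.\<close>
    obtain e i where e: "e \<in> edges G" and i: "0 < i" "i < n" and v_eq: "v = Inner e i"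
      using v by (auto simp: subdivision_def)
    let ?p = "subdiv_path n e"
    have "card e = 2" "e \<subseteq> verts G" using e G by (auto simp: simple_graph_def)
    then have ends: "edge_src e \<in> verts G" "edge_tgt e \<in> verts G"
      using edge_eq_src_tgt(1)[of e] by blast+
    \<comment> \<open>Here \<open>u + 2\<close> is at most \<open>n - 2\<close>, so this position is
      not an end of the path and carries an \<open>Inner\<close> vertex.\<close>
    have p_A: "?p (u + 2) \<in> ?D" if "u \<in> A" for u
      using that e A_sub by (auto simp: subdiv_path_def)
    have p_i: "?p i = v" using i v_eq by (simp add: subdiv_path_def)
    have nbr: "{?p j, v} \<in> edges ?S" if "j = Suc i \<or> i = Suc j" for j
      using that p_i i subdiv_path_in_edges[OF e, of i n] subdiv_path_in_edges[OF e, of j n]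
      by (auto simp: insert_commute)
    \<comment> \<open>By \<open>nbr\<close> it suffices to find a neighbouring position in
      \<open>?D\<close>: an end of \<open>e\<close> for the positions 1 and \<open>n - 1\<close>, a
      shifted element of \<open>A\<close> for the others.\<close>
    have "\<exists>j. ?p j \<in> ?D \<and> (j = Suc i \<or> i = Suc j)"
    proof -
      consider "i = 1" | "i = n - 1" | "2 \<le> i" "i < n - 1" using i by linarith
      then show ?thesis
      proof cases
        case 1
        then show ?thesis using ends by (intro exI[of _ 0]) (simp add: subdiv_path_def)
      next
        case 2
        then show ?thesis using ends n by (intro exI[of _ n]) (simp add: subdiv_path_def)
      next
        case 3
        then have "i - 2 < n - 3" using n by linarith
        \<comment> \<open>As \<open>i\<close> is at least 2, the subtraction is exact, and
          \<open>i - 2\<close> in \<open>A\<close> would put \<open>v\<close> itself into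
          \<open>?D\<close>.\<close>
        moreover have "i - 2 \<notin> A" using v v_eq e 3 by force
        ultimately have "i - 2 \<in> verts (path_graph (n - 3)) - A" by (simp add: path_graph_def)
        then obtain u where "u \<in> A" "{u, i - 2} \<in> edges (path_graph (n - 3))"
          using A unfolding dominating_set_def by blast
        then show ?thesis
          using p_A[of u] 3 by (intro exI[of _ "u + 2"]) (auto simp: path_graph_edge_iff)
      qed
    qed
    then have "\<exists>u\<in>?D. {u, v} \<in> edges ?S" using nbr by blast
    then show ?thesis by (simp add: degree_subdivision_Inner[OF G e i] v_eq)
  qed
  ultimately show ?thesis
    unfolding co_even_dominating_set_def dominating_set_def by blast
qed

theorem theorem3p6:
  fixes G :: "'a graph" and n :: nat
  assumes "simple_graph G" and "n \<ge> 4"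
  shows "co_even_domination_number (subdivision n G)
    \<le> card (verts G) + domination_number (path_graph (n - 3)) * card (edges G)"
proof -
  obtain A where A: "dominating_set (path_graph (n - 3)) A"
    "card A = domination_number (path_graph (n - 3))"
    by (rule domination_number_attained)
  let ?I = "(\<lambda>(e, j). Inner e (j + 2)) ` (edges G \<times> A)"
  have "finite A"
    using A(1) by (auto simp: dominating_set_def path_graph_def intro: finite_subset)
  \<comment> \<open>An upper bound is enough here, so the size of the image is estimated by that of
    the finite product.\<close>
  then have "card ?I \<le> card (edges G) * card A"
    using card_image_le[of "edges G \<times> A" "\<lambda>(e, j). Inner e (j + 2)"]
      simple_graph_finite_edges[OF assms(1)] by (simp add: card_cartesian_product)
  moreover have "card (Orig ` verts G) \<le> card (verts G)"
    using assms(1) by (simp add: simple_graph_def card_image_le)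
  moreover have "co_even_domination_number (subdivision n G) \<le> card (Orig ` verts G \<union> ?I)"
    by (rule co_even_domination_number_le co_even_dominating_set_subdivision assms A(1))+
  ultimately show ?thesis
    using card_Un_le[of "Orig ` verts G" ?I] A(2) by (simp add: mult.commute)
qed

end
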